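(* Let $R$ be a commutative ring. Then $$H^n(\mathrm{S}_{11}(R),\mathrm{M}_3(R)/\mathrm{S}_{11}(R))\cong\begin{cases}R & (n=0,1),\\ 0 & (n\ge2).\end{cases}$$
   Context: $\mathrm{S}_{11}(R)=\left\{\begin{pmatrix}a&b&c\\0&e&d\\0&0&a\end{pmatrix}\mid a,b,c,d,e\in R\right\}\subseteq\mathrm{M}_3(R)$. $H^n$ is Hochschild cohomology, with $\mathrm{M}_3(R)/\mathrm{S}_{11}(R)$ a bimodule via matrix multiplication. *)

theory Defs
  imports "Jordan_Normal_Form.Matrix"
begin

(* Matrices over a commutative ring R are 'r mat (Jordan_Normal_Form); M_3(R) = carrier_mat 3 3.
   Indices are 0-based: entry (i,j) of the paper is X $$ (i-1, j-1). *)

definition S11 :: "('r::comm_ring_1) mat set" where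
  "S11 = {X \<in> carrier_mat 3 3. X $$ (1,0) = 0 \<and> X $$ (2,0) = 0 \<and> X $$ (2,1) = 0
                              \<and> X $$ (2,2) = X $$ (0,0)}"

definition qcls :: "('r::comm_ring_1) mat \<Rightarrow> 'r mat set" where
  "qcls X = {Y \<in> carrier_mat 3 3. Y - X \<in> S11}"

definition Q :: "('r::comm_ring_1) mat set set" where
  "Q = qcls ` carrier_mat 3 3"

definition qrep :: "('r::comm_ring_1) mat set \<Rightarrow> 'r mat" where
  "qrep C = (SOME X. X \<in> C)"

definition qzero :: "('r::comm_ring_1) mat set" where
  "qzero = qcls (0\<^sub>m 3 3)"

definition qadd :: "('r::comm_ring_1) mat set \<Rightarrow> 'r mat set \<Rightarrow> 'r mat set" where
  "qadd C D = qcls (qrep C + qrep D)"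

definition qsmult :: "'r::comm_ring_1 \<Rightarrow> 'r mat set \<Rightarrow> 'r mat set" where
  "qsmult r C = qcls (r \<cdot>\<^sub>m qrep C)"

definition qlact :: "('r::comm_ring_1) mat \<Rightarrow> 'r mat set \<Rightarrow> 'r mat set" where
  "qlact a C = qcls (a * qrep C)"

definition qract :: "('r::comm_ring_1) mat set \<Rightarrow> 'r mat \<Rightarrow> 'r mat set" where
  "qract C a = qcls (qrep C * a)"

definition qsum :: "('r::comm_ring_1) mat set list \<Rightarrow> 'r mat set" where
  "qsum cs = foldr qadd cs qzero"

(* Hochschild n-cochains of A = S_11(R) with values in M = M_3(R)/S_11(R):
   R-multilinear maps A^n -> M (= Hom_R(A^{\<otimes>n}, M)), represented as functions on
   lists of length n, extensional (undefined) outside A^n. *)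
definition cdom :: "nat \<Rightarrow> ('r::comm_ring_1) mat list \<Rightarrow> bool" where
  "cdom n xs \<longleftrightarrow> length xs = n \<and> set xs \<subseteq> S11"

definition cochain :: "nat \<Rightarrow> (('r::comm_ring_1) mat list \<Rightarrow> 'r mat set) \<Rightarrow> bool" where
  "cochain n f \<longleftrightarrow>
     (\<forall>xs. cdom n xs \<longrightarrow> f xs \<in> Q) \<and>
     (\<forall>xs. \<not> cdom n xs \<longrightarrow> f xs = undefined) \<and>
     (\<forall>xs i y z r. cdom n xs \<and> i < n \<and> y \<in> S11 \<and> z \<in> S11 \<longrightarrow>
         f (xs[i := y + z]) = qadd (f (xs[i := y])) (f (xs[i := z])) \<and>
         f (xs[i := r \<cdot>\<^sub>m y]) = qsmult r (f (xs[i := y])))"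

definition hdiff :: "nat \<Rightarrow> (('r::comm_ring_1) mat list \<Rightarrow> 'r mat set) \<Rightarrow> 'r mat list \<Rightarrow> 'r mat set" where
  "hdiff n f xs =
     (if cdom (Suc n) xs then
        qsum ([qlact (hd xs) (f (tl xs))]
              @ map (\<lambda>i. qsmult ((-1) ^ (Suc i))
                           (f (take i xs @ [xs ! i * xs ! Suc i] @ drop (Suc (Suc i)) xs))) [0..<n]
              @ [qsmult ((-1) ^ (Suc n)) (qract (f (take n xs)) (xs ! n))])
      else undefined)"

definition czero :: "nat \<Rightarrow> ('r::comm_ring_1) mat list \<Rightarrow> 'r mat set" where
  "czero n xs = (if cdom n xs then qzero else undefined)"

definition cadd :: "nat \<Rightarrow> (('r::comm_ring_1) mat list \<Rightarrow> 'r mat set) \<Rightarrow> ('r mat list \<Rightarrow> 'r mat set)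
                      \<Rightarrow> 'r mat list \<Rightarrow> 'r mat set" where
  "cadd n f g xs = (if cdom n xs then qadd (f xs) (g xs) else undefined)"

definition csmult :: "nat \<Rightarrow> 'r::comm_ring_1 \<Rightarrow> ('r mat list \<Rightarrow> 'r mat set) \<Rightarrow> 'r mat list \<Rightarrow> 'r mat set" where
  "csmult n r f xs = (if cdom n xs then qsmult r (f xs) else undefined)"

definition ZZ :: "nat \<Rightarrow> (('r::comm_ring_1) mat list \<Rightarrow> 'r mat set) set" where
  "ZZ n = {f. cochain n f \<and> hdiff n f = czero (Suc n)}"

definition BB :: "nat \<Rightarrow> (('r::comm_ring_1) mat list \<Rightarrow> 'r mat set) set" where
  "BB n = (if n = 0 then {czero 0} else {hdiff (n - 1) g | g. cochain (n - 1) g})"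

definition hcls :: "nat \<Rightarrow> (('r::comm_ring_1) mat list \<Rightarrow> 'r mat set) \<Rightarrow> ('r mat list \<Rightarrow> 'r mat set) set" where
  "hcls n f = {cadd n f b | b. b \<in> BB n}"

definition HH :: "nat \<Rightarrow> ((('r::comm_ring_1) mat list \<Rightarrow> 'r mat set) set) set" where
  "HH n = hcls n ` ZZ n"

end

theory Submission
  imports Defs "HOL-Library.Product_Plus" "HOL-Library.Function_Algebras"
begin

text \<open>
  Put \<open>u = E\<^bsub>11\<^esub> + E\<^bsub>33\<^esub>\<close>, \<open>e = E\<^bsub>22\<^esub>\<close>, \<open>x = E\<^bsub>12\<^esub>\<close>, \<open>y = E\<^bsub>23\<^esub>\<close>, \<open>z = E\<^bsub>13\<^esub>\<close>. The algebra \<open>A\<close> of the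
  theorem is the path algebra of the quiver with vertices \<open>u\<close>, \<open>e\<close> and arrows \<open>x\<close>, \<open>y\<close>, with the
  relation \<open>yx = 0\<close> (and \<open>xy = z\<close>), and \<open>M = M\<^sub>3(R)/A\<close> satisfies \<open>eMe = 0\<close>.

  A cocycle of degree \<open>n \<ge> 2\<close> is a 2-cocycle \<open>f\<close> of \<open>A\<close> with values in \<open>N = C\<^bsup>n-2\<^esup>(A, M)\<close>. After
  averaging, \<open>f\<close> vanishes when its first argument is \<open>u\<close> or \<open>e\<close>. A primitive is then determined by its
  values on \<open>x\<close> and \<open>y\<close>; the relation \<open>yx = 0\<close> imposes one condition, which asks to write an element of
  \<open>eNe\<close> as \<open>\<phi>x\<close> with \<open>\<phi> \<in> eNu\<close>. This is possible because \<open>eNe = 0\<close> for \<open>N = M\<close>, and because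
  \<open>a \<mapsto> xa\<close> is split injective on \<open>eA\<close> in higher degrees.

  In degree 0 the invariants of \<open>M\<close> are spanned by the class of \<open>E\<^bsub>11\<^esub>\<close>. In degree 1 a derivation is
  given, up to inner ones, by its components in \<open>uMe \<cong> R\<close> at \<open>x\<close> and in \<open>eMu \<cong> R\<close> at \<open>y\<close>, modulo the
  antidiagonal, which comes from \<open>E\<^bsub>31\<^esub>\<close>.
\<close>

section \<open>The algebra and the bimodule in coordinates\<close>

declare split_paired_All [simp del] split_paired_Ex [simp del]

text \<open>An element \<open>(a, b, c, d, e)\<close> of the algebra is \<open>a u + b x + c z + d y + e E\<^bsub>22\<^esub>\<close>; an element
  \<open>(p, w, q, f)\<close> of the bimodule is the class of \<open>p E\<^bsub>21\<^esub> + w E\<^bsub>31\<^esub> + q E\<^bsub>32\<^esub> + f E\<^bsub>11\<^esub>\<close>, where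
  \<open>E\<^bsub>33\<^esub> = - E\<^bsub>11\<^esub>\<close>.\<close>

type_synonym 'r alg = "'r \<times> 'r \<times> 'r \<times> 'r \<times> 'r"
type_synonym 'r quot = "'r \<times> 'r \<times> 'r \<times> 'r"
type_synonym 'r coch = "'r alg list \<Rightarrow> 'r quot"

fun amul :: "'r::comm_ring_1 alg \<Rightarrow> 'r alg \<Rightarrow> 'r alg" (infixl \<open>\<star>\<close> 70) where
  "(a, b, c, d, e) \<star> (a', b', c', d', e') =
     (a * a', a * b' + b * e', a * c' + b * d' + c * a', e * d' + d * a', e * e')"

fun ascale :: "'r::comm_ring_1 \<Rightarrow> 'r alg \<Rightarrow> 'r alg" where
  "ascale r (a, b, c, d, e) = (r * a, r * b, r * c, r * d, r * e)"

fun mscale :: "'r::comm_ring_1 \<Rightarrow> 'r quot \<Rightarrow> 'r quot" where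
  "mscale r (p, w, q, f) = (r * p, r * w, r * q, r * f)"

fun lmul :: "'r::comm_ring_1 alg \<Rightarrow> 'r quot \<Rightarrow> 'r quot" where
  "lmul (a, b, c, d, e) (p, w, q, f) = (e * p + d * w, a * w, a * q, a * f + b * p + c * w)"

text \<open>The minus signs come from the lower right corner: in the quotient E33 = - E11, so what
  lands there is subtracted from the last coordinate.\<close>

fun rmul :: "'r::comm_ring_1 quot \<Rightarrow> 'r alg \<Rightarrow> 'r quot" where
  "rmul (p, w, q, f) (a, b, c, d, e) = (p * a, w * a, q * e + w * b, f * a - w * c - q * d)"

definition aU :: "'r::comm_ring_1 alg" where "aU = (1, 0, 0, 0, 0)"
definition aX :: "'r::comm_ring_1 alg" where "aX = (0, 1, 0, 0, 0)"
definition aZ :: "'r::comm_ring_1 alg" where "aZ = (0, 0, 1, 0, 0)"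
definition aY :: "'r::comm_ring_1 alg" where "aY = (0, 0, 0, 1, 0)"
definition aE :: "'r::comm_ring_1 alg" where "aE = (0, 0, 0, 0, 1)"

lemmas basis_defs = aU_def aX_def aZ_def aY_def aE_def

lemma amul_basis [simp]:
  "aU \<star> aU = aU" "aU \<star> aX = aX" "aU \<star> aZ = aZ" "aU \<star> aY = 0" "aU \<star> aE = 0"
  "aX \<star> aU = 0" "aX \<star> aX = 0" "aX \<star> aZ = 0" "aX \<star> aY = aZ" "aX \<star> aE = aX"
  "aZ \<star> aU = aZ" "aZ \<star> aX = 0" "aZ \<star> aZ = 0" "aZ \<star> aY = 0" "aZ \<star> aE = 0"
  "aY \<star> aU = aY" "aY \<star> aX = 0" "aY \<star> aZ = 0" "aY \<star> aY = 0" "aY \<star> aE = 0"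
  "aE \<star> aU = 0" "aE \<star> aX = 0" "aE \<star> aZ = 0" "aE \<star> aY = aY" "aE \<star> aE = aE"
  by (simp_all add: basis_defs zero_prod_def)

lemma amul_assoc: "(a \<star> b) \<star> c = a \<star> (b \<star> c)"
  by (cases a; cases b; cases c) (simp add: algebra_simps)

lemma amul_linear:
  "(a + b) \<star> c = a \<star> c + b \<star> c" "a \<star> (b + c) = a \<star> b + a \<star> c"
  "ascale r a \<star> b = ascale r (a \<star> b)" "a \<star> ascale r b = ascale r (a \<star> b)"
  by (cases a; cases b; cases c; simp add: algebra_simps)+

lemma mscale_linear [simp]:
  "mscale r (m + m') = mscale r m + mscale r m'" "mscale r (m - m') = mscale r m - mscale r m'"
  "mscale r (- m) = - mscale r m" "mscale r 0 = 0" "mscale 1 m = m" "mscale 0 m = 0"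
  "mscale (-1) m = - m"
  by (cases m; cases m'; simp add: algebra_simps zero_prod_def)+

lemma mscale_mscale [simp]: "mscale r (mscale s m) = mscale (r * s) m"
  by (cases m) (simp add: algebra_simps)

lemma mscale_add: "mscale (r + s) m = mscale r m + mscale s m"
  by (cases m) (simp add: algebra_simps)

lemma mscale_minus_left: "mscale (- r) m = - mscale r m"
  by (cases m) simp

lemma lmul_linear:
  "lmul (a + b) m = lmul a m + lmul b m" "lmul a (m + m') = lmul a m + lmul a m'"
  "lmul a (m - m') = lmul a m - lmul a m'" "lmul a (- m) = - lmul a m"
  "lmul (ascale r a) m = mscale r (lmul a m)" "lmul a (mscale r m) = mscale r (lmul a m)"
  by (cases a; cases b; cases m; cases m'; simp add: algebra_simps)+

lemma rmul_linear:
  "rmul m (a + b) = rmul m a + rmul m b" "rmul (m + m') a = rmul m a + rmul m' a"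
  "rmul (m - m') a = rmul m a - rmul m' a" "rmul (- m) a = - rmul m a"
  "rmul m (ascale r a) = mscale r (rmul m a)" "rmul (mscale r m) a = mscale r (rmul m a)"
  by (cases a; cases b; cases m; cases m'; simp add: algebra_simps)+

lemma mul_zero [simp]: "lmul 0 m = 0" "lmul a 0 = 0" "rmul m 0 = 0" "rmul 0 a = 0"
  by (cases a; cases m; simp add: zero_prod_def)+

lemma lmul_lmul: "lmul a (lmul b m) = lmul (a \<star> b) m"
  by (cases a; cases b; cases m) (simp add: algebra_simps)

lemma rmul_rmul: "rmul (rmul m a) b = rmul m (a \<star> b)"
  by (cases a; cases b; cases m) (simp add: algebra_simps)

lemma lmul_rmul: "lmul a (rmul m b) = rmul (lmul a m) b"
  by (cases a; cases b; cases m) (simp add: algebra_simps)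

lemma lmul_unit: "lmul aU m + lmul aE m = m"
  by (cases m) (simp add: basis_defs)

section \<open>Multilinear cochains of all degrees at once\<close>

text \<open>A function on lists of every length stands for a family of cochains, one per degree.
  Thus no length conditions arise, and fixing the first argument gives an object of the same
  kind.\<close>

definition multilinear :: "'r::comm_ring_1 coch \<Rightarrow> bool" where
  "multilinear F \<longleftrightarrow> (\<forall>as bs a b r.
     F (as @ (a + b) # bs) = F (as @ a # bs) + F (as @ b # bs) \<and>
     F (as @ ascale r a # bs) = mscale r (F (as @ a # bs)))"

lemma multilinear_add: "multilinear F \<Longrightarrow> F (as @ (a + b) # bs) = F (as @ a # bs) + F (as @ b # bs)"
  and multilinear_scale: "multilinear F \<Longrightarrow> F (as @ ascale r a # bs) = mscale r (F (as @ a # bs))"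
  unfolding multilinear_def by blast+

lemma multilinear_hd:
  assumes "multilinear F"
  shows "F ((a + b) # bs) = F (a # bs) + F (b # bs)" "F (ascale r a # bs) = mscale r (F (a # bs))"
    "F (c # (a + b) # bs) = F (c # a # bs) + F (c # b # bs)"
    "F (c # ascale r a # bs) = mscale r (F (c # a # bs))"
  using multilinear_add[OF assms, of "[]"] multilinear_add[OF assms, of "[c]"]
    multilinear_scale[OF assms, of "[]"] multilinear_scale[OF assms, of "[c]"] by simp_all

lemma multilinear_hd_zero:
  assumes "multilinear F"
  shows "F (0 # bs) = 0" "F (c # 0 # bs) = 0"
  using multilinear_hd(1)[OF assms, of 0 0] multilinear_hd(3)[OF assms, of _ 0 0] by simp_all

lemma multilinear_Cons: "multilinear F \<Longrightarrow> multilinear (\<lambda>bs. F (a # bs))"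
  unfolding multilinear_def by (metis append_Cons)

lemma multilinear_add_fun: "multilinear F \<Longrightarrow> multilinear G \<Longrightarrow> multilinear (F + G)"
  and multilinear_diff: "multilinear F \<Longrightarrow> multilinear G \<Longrightarrow> multilinear (F - G)"
  and multilinear_minus: "multilinear F \<Longrightarrow> multilinear (- F)"
  and multilinear_lmul: "multilinear F \<Longrightarrow> multilinear (\<lambda>bs. lmul a (F bs))"
  and multilinear_mscale: "multilinear F \<Longrightarrow> multilinear (\<lambda>bs. mscale r (F bs))"
  unfolding multilinear_def by (simp_all add: lmul_linear mult.commute algebra_simps)

lemmas multilinear_closed = multilinear_add_fun multilinear_diff multilinear_minus multilinear_lmul
  multilinear_mscale

lemma multilinear_zero: "multilinear 0"
  unfolding multilinear_def by simp

section \<open>The right action on cochains and the differential\<close>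

text \<open>The non-unital right action on \<open>N = C\<^sup>n(A, M)\<close> for which the Hochschild differential of \<open>F\<close>,
  read as a map \<open>A \<rightarrow> N\<close>, becomes \<open>a F(b) - F(ab) + F(a) b\<close>.\<close>

fun ract :: "'r::comm_ring_1 coch \<Rightarrow> 'r alg \<Rightarrow> 'r coch" where
  "ract F a [] = rmul (F []) a"
| "ract F a (b # bs) = F (a \<star> b # bs) - ract (\<lambda>cs. F (a # cs)) b bs"

lemma ract_linear:
  "ract (F + G) a bs = ract F a bs + ract G a bs" "ract (F - G) a bs = ract F a bs - ract G a bs"
  "ract (- F) a bs = - ract F a bs" "ract (\<lambda>bs. mscale r (F bs)) a bs = mscale r (ract F a bs)"
  "ract (\<lambda>bs. lmul c (F bs)) a bs = lmul c (ract F a bs)"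
proof -
  have "ract (\<lambda>bs. F bs + G bs) a bs = ract F a bs + ract G a bs \<and>
    ract (\<lambda>bs. F bs - G bs) a bs = ract F a bs - ract G a bs \<and>
    ract (\<lambda>bs. - F bs) a bs = - ract F a bs \<and>
    ract (\<lambda>bs. mscale r (F bs)) a bs = mscale r (ract F a bs) \<and>
    ract (\<lambda>bs. lmul c (F bs)) a bs = lmul c (ract F a bs)"
    by (induction bs arbitrary: F G a) (simp_all add: rmul_linear lmul_linear lmul_rmul)
  then show
    "ract (F + G) a bs = ract F a bs + ract G a bs" "ract (F - G) a bs = ract F a bs - ract G a bs"
    "ract (- F) a bs = - ract F a bs" "ract (\<lambda>bs. mscale r (F bs)) a bs = mscale r (ract F a bs)"
    "ract (\<lambda>bs. lmul c (F bs)) a bs = lmul c (ract F a bs)"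
    by (simp_all add: plus_fun_def fun_diff_def fun_Compl_def)
qed

lemma ract_zero: "ract (\<lambda>_. 0) a bs = 0"
  using ract_linear(4)[of 0 "\<lambda>_. 0"] by simp

lemma ract_linear_right:
  assumes "multilinear F"
  shows "ract F (a + b) bs = ract F a bs + ract F b bs" "ract F (ascale r a) bs = mscale r (ract F a bs)"
  using assms
proof (induction bs arbitrary: F a b)
  case Nil
  { case 1 show ?case by (simp add: rmul_linear) }
  { case 2 show ?case by (simp add: rmul_linear) }
next
  case (Cons c cs)
  { case 1
    have "(\<lambda>cs. F ((a + b) # cs)) = (\<lambda>cs. F (a # cs)) + (\<lambda>cs. F (b # cs))"
      by (simp add: fun_eq_iff multilinear_hd[OF 1])
    then show ?case
      by (simp add: amul_linear multilinear_hd[OF 1] ract_linear) }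
  { case 2
    have "(\<lambda>cs. F (ascale r a # cs)) = (\<lambda>cs. mscale r (F (a # cs)))"
      by (simp add: fun_eq_iff multilinear_hd[OF 2])
    then show ?case
      by (simp add: amul_linear multilinear_hd[OF 2] ract_linear) }
qed

lemma multilinear_ract:
  assumes "multilinear F"
  shows "multilinear (ract F a)"
proof -
  have "ract F a (as @ (b + c) # bs) = ract F a (as @ b # bs) + ract F a (as @ c # bs) \<and>
     ract F a (as @ ascale r b # bs) = mscale r (ract F a (as @ b # bs))" for as b c bs r
    using assms
  proof (induction as arbitrary: F a)
    case Nil
    then show ?case
      by (simp add: amul_linear multilinear_hd ract_linear_right[OF multilinear_Cons])
  next
    case (Cons d as)
    then show ?case
      using Cons.IH[OF multilinear_Cons[OF Cons.prems, of a], of d]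
        multilinear_add[OF Cons.prems, of "a \<star> d # as"]
        multilinear_scale[OF Cons.prems, of "a \<star> d # as"]
      by simp
  qed
  then show ?thesis unfolding multilinear_def by blast
qed

text \<open>Unfolding at the first argument leaves two terms built from
  \<open>\<lambda>cs. F (a # cs)\<close>, which cancel by the induction hypothesis.\<close>

lemma ract_ract: "ract (ract F a) b bs = ract F (a \<star> b) bs"
proof (induction bs arbitrary: F a b)
  case Nil
  show ?case by (simp add: rmul_rmul)
next
  case (Cons c cs)
  have "(\<lambda>cs. ract F a (b # cs)) = (\<lambda>cs. F (a \<star> b # cs)) - ract (\<lambda>cs. F (a # cs)) b"
    by (simp add: fun_eq_iff)
  then show ?case
    by (simp add: amul_assoc ract_linear Cons.IH)
qed

text \<open>In this form the differential is a commutator with the first argument, free of signs and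
  sums. The value at \<open>[]\<close> reflects that there is nothing in degree -1.\<close>

fun delta :: "'r::comm_ring_1 coch \<Rightarrow> 'r coch" where
  "delta F [] = 0"
| "delta F (a # bs) = lmul a (F bs) - ract F a bs"

lemma delta_linear:
  fixes F :: "'r::comm_ring_1 coch"
  shows "delta (F + G) = delta F + delta G" "delta (F - G) = delta F - delta G" "delta (0 :: 'r coch) = 0"
  "delta (\<lambda>xs. mscale r (F xs)) = (\<lambda>xs. mscale r (delta F xs))"
proof -
  have 0: "(0 :: 'r coch) = (\<lambda>_. 0)" by (simp add: fun_eq_iff)
  have "delta (F + G) xs = delta F xs + delta G xs" "delta (F - G) xs = delta F xs - delta G xs"
    "delta (0 :: 'r coch) xs = 0"
    "delta (\<lambda>xs. mscale r (F xs)) xs = mscale r (delta F xs)" for xs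
    by (cases xs; simp add: lmul_linear ract_linear ract_zero 0)+
  then show "delta (F + G) = delta F + delta G" "delta (F - G) = delta F - delta G"
    "delta (0 :: 'r coch) = 0"
    "delta (\<lambda>xs. mscale r (F xs)) = (\<lambda>xs. mscale r (delta F xs))" by (simp_all add: fun_eq_iff)
qed

text \<open>Expanding the two commutators, everything cancels by associativity of the left action
  and of \<open>ract\<close>, and because the two actions commute.\<close>

lemma delta_delta: "delta (delta G) = 0"
proof -
  have "delta (delta G) xs = 0" for xs
  proof (cases xs rule: list.exhaust)
    case (Cons a as)
    then show ?thesis
    proof (cases as)
      case (Cons b bs)
      have "(\<lambda>cs. delta G (a # cs)) = (\<lambda>cs. lmul a (G cs)) - ract G a"
        by (simp add: fun_eq_iff)
      then show ?thesis
        by (simp add: \<open>xs = a # as\<close> Cons lmul_linear lmul_lmul ract_linear ract_ract)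
    qed simp
  qed simp
  then show ?thesis by (simp add: fun_eq_iff)
qed

lemma multilinear_delta:
  assumes "multilinear G"
  shows "multilinear (delta G)"
proof -
  have "delta G (as @ (b + c) # bs) = delta G (as @ b # bs) + delta G (as @ c # bs) \<and>
     delta G (as @ ascale r b # bs) = mscale r (delta G (as @ b # bs))" for as b c bs r
    using assms multilinear_ract[OF assms]
    by (cases as) (simp_all add: lmul_linear ract_linear_right multilinear_add multilinear_scale)
  then show ?thesis unfolding multilinear_def by blast
qed

lemma delta_Cons2:
  "delta F (a # b # bs) = lmul a (F (b # bs)) - F (a \<star> b # bs) + ract (\<lambda>cs. F (a # cs)) b bs"
  by simp

text \<open>The 2-cocycle identity with values in cochains of the remaining arguments, solved for
  the right action so that rewriting eliminates \<open>ract\<close>.\<close>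

lemma cocycle3:
  assumes "delta F = 0"
  shows "ract (\<lambda>cs. F (a # b # cs)) c bs =
    lmul a (F (b # c # bs)) - F (a \<star> b # c # bs) + F (a # b \<star> c # bs)"
proof -
  have "delta F (a # b # c # bs) = 0" by (simp add: assms)
  then show ?thesis by (simp add: algebra_simps)
qed

section \<open>Vanishing criterion and normalisation of cocycles\<close>

lemma alg_decomp:
  "(a, b, c, d, e) = ascale a aU + ascale b aX + ascale c aZ + ascale d aY + ascale e aE"
  by (simp add: basis_defs)

lemma alg_ext:
  assumes "\<And>a b. P a = 0 \<Longrightarrow> P b = 0 \<Longrightarrow> P (a + b) = (0 :: 'm::zero)" "\<And>r a. P a = 0 \<Longrightarrow> P (ascale r a) = 0"
    and "P aU = 0" "P aX = 0" "P aZ = 0" "P aY = 0" "P aE = 0"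
  shows "P a = 0"
  by (cases a) (simp only: alg_decomp, intro assms)

lemma multilinear_ext1:
  assumes "multilinear F" and "F (aU # bs) = 0" "F (aX # bs) = 0" "F (aZ # bs) = 0"
    "F (aY # bs) = 0" "F (aE # bs) = 0"
  shows "F (a # bs) = 0"
  by (rule alg_ext[where P = "\<lambda>a. F (a # bs)"]) (use assms in \<open>simp_all add: multilinear_hd\<close>)

lemma multilinear_ext2:
  assumes "multilinear F" and "F (c # aU # bs) = 0" "F (c # aX # bs) = 0" "F (c # aZ # bs) = 0"
    "F (c # aY # bs) = 0" "F (c # aE # bs) = 0"
  shows "F (c # a # bs) = 0"
  by (rule multilinear_ext1[OF multilinear_Cons]) fact+

text \<open>The cocycle identity at (x, e, b) and (y, u, b) replaces the second argument b by eb and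
  ub, so only the pairs (x, e), (x, y), (y, u), (y, x), (y, z) matter. The last one follows from the
  identity at (y, x, y), where yx = 0 and xy = z; first argument z follows from (x, y, b).\<close>

lemma cocycle_eq_zero:
  fixes F :: "'r::comm_ring_1 coch"
  assumes F: "multilinear F" "delta F = 0" and F0: "F [] = 0" "\<And>a. F [a] = 0"
    and U: "\<And>a bs. F (aU # a # bs) = 0" and E: "\<And>a bs. F (aE # a # bs) = 0"
    and XE: "\<And>bs. F (aX # aE # bs) = 0" and XY: "\<And>bs. F (aX # aY # bs) = 0"
    and YU: "\<And>bs. F (aY # aU # bs) = 0" and YX: "\<And>bs. F (aY # aX # bs) = 0"
  shows "F = 0"
proof -
  note z = ract_zero multilinear_hd_zero[OF F(1)]
  have XE': "F (aX # b # bs) = F (aX # aE \<star> b # bs)" for b bs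
    using cocycle3[OF F(2), of aX aE b bs] by (simp add: XE E z)
  have X: "F (aX # b # bs) = 0" for b bs
    by (rule multilinear_ext2[OF F(1)]; subst XE') (simp_all add: XE XY z)
  have YU': "F (aY # b # bs) = F (aY # aU \<star> b # bs)" for b bs
    using cocycle3[OF F(2), of aY aU b bs] by (simp add: YU U z)
  have YZ: "F (aY # aZ # bs) = 0" for bs
    using cocycle3[OF F(2), of aY aX aY bs] by (simp add: YX XY z)
  have Y: "F (aY # b # bs) = 0" for b bs
    by (rule multilinear_ext2[OF F(1)]; subst YU') (simp_all add: YU YX YZ z)
  have Z: "F (aZ # b # bs) = 0" for b bs
    using cocycle3[OF F(2), of aX aY b bs] by (simp add: X Y z)
  have "F (a # b # bs) = 0" for a b bs
    by (rule multilinear_ext1[OF F(1)]) (simp_all add: U E X Y Z)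
  then have "F xs = 0" for xs
    using F0 by (cases xs rule: remdups_adj.cases) auto
  then show ?thesis by (simp add: fun_eq_iff)
qed

text \<open>Averaging over the separability idempotent \<open>u \<otimes> u + e \<otimes> e\<close> of the diagonal subalgebra.\<close>

lemma cocycle_normalise:
  fixes F :: "'r::comm_ring_1 coch"
  assumes F: "multilinear F" "delta F = 0" and F0: "F [] = 0" "\<And>a. F [a] = 0"
  obtains G where "multilinear G" "G [] = 0"
    "\<And>bs. (F - delta G) (aU # bs) = 0" "\<And>bs. (F - delta G) (aE # bs) = 0"
proof -
  define G :: "'r coch" where "G = (\<lambda>bs. case bs of [] \<Rightarrow> 0 |
    a # bs \<Rightarrow> lmul aU (F (aU # a # bs)) + lmul aE (F (aE # a # bs)))"
  have G: "multilinear G"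
  proof -
    have "G (as @ (b + c) # bs) = G (as @ b # bs) + G (as @ c # bs) \<and>
      G (as @ ascale r b # bs) = mscale r (G (as @ b # bs))" for as b c bs r
      using multilinear_lmul[OF multilinear_Cons[OF F(1)], unfolded multilinear_def,
        rule_format, of aU aU as b c bs r]
        multilinear_lmul[OF multilinear_Cons[OF F(1)], unfolded multilinear_def,
        rule_format, of aE aE as b c bs r]
      by (cases as) (simp_all add: G_def)
    then show ?thesis unfolding multilinear_def by blast
  qed
  have ract_G: "ract (\<lambda>cs. G (a # cs)) b bs =
     lmul aU (ract (\<lambda>cs. F (aU # a # cs)) b bs) + lmul aE (ract (\<lambda>cs. F (aE # a # cs)) b bs)" for a b bs
  proof -
    have "(\<lambda>cs. G (a # cs)) = (\<lambda>cs. lmul aU (F (aU # a # cs))) + (\<lambda>cs. lmul aE (F (aE # a # cs)))"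
      by (simp add: fun_eq_iff G_def)
    then show ?thesis by (simp add: ract_linear)
  qed
  \<comment> \<open>The cocycle identity removes the right action, and \<open>F (a # b # bs)\<close>
    cancels because u + e acts as the identity. At a = u and a = e the remaining terms cancel, as u
    and e are orthogonal idempotents.\<close>
  have "(F - delta G) (a # b # bs) =
     lmul aU (F (aU \<star> a # b # bs)) + lmul aE (F (aE \<star> a # b # bs))
     - lmul (a \<star> aU) (F (aU # b # bs)) - lmul (a \<star> aE) (F (aE # b # bs))" for a b bs
    using lmul_unit[of "F (a # b # bs)"]
    by (simp add: delta_Cons2 ract_G cocycle3[OF F(2)] lmul_linear lmul_lmul del: delta.simps)
      (simp add: G_def lmul_linear lmul_lmul algebra_simps)
  then have *: "(F - delta G) (aU # b # bs) = 0" "(F - delta G) (aE # b # bs) = 0" for b bs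
    by (simp_all add: multilinear_hd_zero[OF F(1)])
  \<comment> \<open>Here the default \<open>G [] = 0\<close> matters: it makes
    \<open>delta G [a]\<close> vanish.\<close>
  have "(F - delta G) [a] = 0" for a
    by (simp add: F0 G_def)
  note ** = this
  have "(F - delta G) (aU # bs) = 0" for bs
  proof (cases bs)
    case Nil
    show ?thesis unfolding Nil by (rule **)
  next
    case (Cons c cs)
    show ?thesis unfolding Cons by (rule *)
  qed
  moreover have "(F - delta G) (aE # bs) = 0" for bs
  proof (cases bs)
    case Nil
    show ?thesis unfolding Nil by (rule **)
  next
    case (Cons c cs)
    show ?thesis unfolding Cons by (rule *)
  qed
  moreover have "G [] = 0" by (simp add: G_def)
  ultimately show ?thesis using that G by blast
qed

section \<open>Exactness in degrees at least two\<close>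

lemma ract_zero_fun: "ract 0 a = 0"
  by (simp add: fun_eq_iff zero_fun_def ract_zero)

fun shiftX :: "'r::comm_ring_1 alg \<Rightarrow> 'r alg" where
  "shiftX (a, b, c, d, e) = (0, 0, 0, c, b)"

lemma shiftX_linear: "shiftX (a + b) = shiftX a + shiftX b" "shiftX (ascale r a) = ascale r (shiftX a)"
  by (cases a; cases b; simp)+

lemma shiftX_aX: "shiftX (aX \<star> b) = aE \<star> b" "shiftX aX = aE"
  by (cases b; simp add: basis_defs)+

text \<open>Right multiplication by \<open>x\<close> maps onto the \<open>\<psi>\<close> with \<open>e\<psi>e = \<psi>\<close>, because \<open>eA \<rightarrow> A\<close>, \<open>a \<mapsto> xa\<close>
  has the retraction \<open>shiftX\<close>; in degree zero because \<open>eMe = 0\<close>.\<close>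

lemma ract_aX_surj:
  fixes \<psi> :: "'r::comm_ring_1 coch"
  assumes "multilinear \<psi>" and e\<psi>: "\<And>bs. lmul aE (\<psi> bs) = \<psi> bs" and \<psi>e: "ract \<psi> aE = \<psi>"
  obtains \<phi> where "multilinear \<phi>" "\<And>bs. lmul aE (\<phi> bs) = \<phi> bs" "ract \<phi> aU = \<phi>" "ract \<phi> aX = \<psi>"
proof -
  define \<theta> :: "'r coch" where "\<theta> = (\<lambda>bs. case bs of [] \<Rightarrow> 0 | b # bs \<Rightarrow> \<psi> (shiftX b # bs))"
  have \<theta>: "multilinear \<theta>"
    unfolding multilinear_def
  proof (intro allI)
    fix as bs :: "'r alg list" and a b r
    show "\<theta> (as @ (a + b) # bs) = \<theta> (as @ a # bs) + \<theta> (as @ b # bs) \<and>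
      \<theta> (as @ ascale r a # bs) = mscale r (\<theta> (as @ a # bs))"
    proof (cases as)
      case Nil
      then show ?thesis
        using multilinear_hd[OF assms(1)] by (simp add: \<theta>_def shiftX_linear)
    next
      case (Cons c cs)
      then show ?thesis
        using multilinear_add[OF assms(1), of "shiftX c # cs"]
          multilinear_scale[OF assms(1), of "shiftX c # cs"] by (simp add: \<theta>_def)
    qed
  qed
  have \<theta>x: "ract \<theta> aX bs = \<psi> bs" for bs
  proof (cases bs)
    case Nil
    have "lmul aE (rmul m aE) = 0" for m :: "'r quot"
      by (cases m) (simp add: basis_defs zero_prod_def)
    then have "\<psi> [] = 0"
      using e\<psi>[of "[]"] fun_cong[OF \<psi>e, of "[]"] by (metis ract.simps(1))
    then show ?thesis by (simp add: Nil \<theta>_def)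
  next
    case (Cons c cs)
    \<comment> \<open>\<open>shiftX\<close> sends xc to ec and x to e, so both terms of the action
      by x on \<open>\<theta>\<close> become those of the action by e on
      \<open>\<psi>\<close>.\<close>
    have "ract \<theta> aX (c # cs) = ract \<psi> aE (c # cs)"
      by (simp add: \<theta>_def shiftX_aX)
    then show ?thesis by (simp add: Cons \<psi>e)
  qed
  have e\<theta>: "lmul aE (\<theta> bs) = \<theta> bs" for bs
    by (cases bs) (simp_all add: \<theta>_def e\<psi>)
  \<comment> \<open>The witness is \<open>ract \<theta> aU\<close>: it is fixed by u since uu = u,
    and x acts on it as on \<open>\<theta>\<close> since ux = x.\<close>
  show ?thesis
  proof
    show "multilinear (ract \<theta> aU)" by (rule multilinear_ract[OF \<theta>])
    show "lmul aE (ract \<theta> aU bs) = ract \<theta> aU bs" for bs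
      by (simp flip: ract_linear(5) add: e\<theta>)
    show "ract (ract \<theta> aU) aU = ract \<theta> aU" "ract (ract \<theta> aU) aX = \<psi>"
      by (simp_all add: fun_eq_iff ract_ract \<theta>x)
  qed
qed

text \<open>The general shape of a normalised primitive: in the first argument it vanishes at u and
  e, and \<open>g\<close>, \<open>h\<close>, \<open>k\<close> are its values at x, y and z.\<close>

fun extend :: "'r::comm_ring_1 coch \<Rightarrow> 'r coch \<Rightarrow> 'r coch \<Rightarrow> 'r coch" where
  "extend g h k [] = 0"
| "extend g h k ((a, b, c, d, e) # bs) = mscale b (g bs) + mscale d (h bs) + mscale c (k bs)"

lemma extend_basis [simp]:
  "extend g h k (aU # bs) = 0" "extend g h k (aX # bs) = g bs" "extend g h k (aZ # bs) = k bs"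
  "extend g h k (aY # bs) = h bs" "extend g h k (aE # bs) = 0" "extend g h k (0 # bs) = 0"
  by (simp_all add: basis_defs zero_prod_def[where 'b = "'a \<times> 'a \<times> 'a \<times> 'a"]
      zero_prod_def[where 'b = "'a \<times> 'a \<times> 'a"] zero_prod_def[where 'b = "'a \<times> 'a"]
      zero_prod_def[where 'b = "'a"])

lemma multilinear_extend:
  assumes "multilinear g" "multilinear h" "multilinear k"
  shows "multilinear (extend g h k)"
  unfolding multilinear_def
proof (intro allI)
  fix as bs a b r
  show "extend g h k (as @ (a + b) # bs) = extend g h k (as @ a # bs) + extend g h k (as @ b # bs) \<and>
    extend g h k (as @ ascale r a # bs) = mscale r (extend g h k (as @ a # bs))"
  proof (cases as)
    case Nil
    then show ?thesis
      by (cases a; cases b) (simp add: mscale_add algebra_simps)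
  next
    case (Cons c cs)
    then show ?thesis
      by (cases c) (simp add: assms[THEN multilinear_add] assms[THEN multilinear_scale]
          mult.commute algebra_simps)
  qed
qed

text \<open>A primitive of the form \<open>extend g h k\<close> need only match \<open>F\<close> at
  the four pairs of \<open>cocycle_eq_zero\<close>. The pair (x, e) is met by a choice of
  \<open>g\<close> and (x, y) by a choice of \<open>k\<close>, while (y, u) and (y, x) both
  constrain \<open>h\<close>; reconciling these two is where \<open>ract_aX_surj\<close>
  enters.\<close>

lemma normalised_cocycle_exact:
  fixes F :: "'r::comm_ring_1 coch"
  assumes F: "multilinear F" "delta F = 0" and F0: "F [] = 0" "\<And>a. F [a] = 0"
    and U: "\<And>bs. F (aU # bs) = 0" and E: "\<And>bs. F (aE # bs) = 0"
  obtains G where "multilinear G" "delta G = F"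
proof -
  note z = ract_zero multilinear_hd_zero[OF F(1)]
  \<comment> \<open>Vanishing at u and e makes \<open>F\<close> equivariant for the left action of
    the diagonal.\<close>
  have UF: "lmul aU (F (a # b # bs)) = F (aU \<star> a # b # bs)"
    and EF: "lmul aE (F (a # b # bs)) = F (aE \<star> a # b # bs)" for a b bs
    using cocycle3[OF F(2), of aU a b bs] cocycle3[OF F(2), of aE a b bs] by (simp_all add: U E z)
  define XE where "XE = (\<lambda>bs. F (aX # aE # bs))"
  define YU where "YU = (\<lambda>bs. F (aY # aU # bs))"
  define XY where "XY = (\<lambda>bs. F (aX # aY # bs))"
  define YX where "YX = (\<lambda>bs. F (aY # aX # bs))"
  note defs = XE_def YU_def XY_def YX_def
  have ml: "multilinear XE" "multilinear YU" "multilinear XY" "multilinear YX"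
    unfolding defs by (intro multilinear_Cons F(1))+
  \<comment> \<open>The cocycle identity at (x, e, e), (y, u, u), (y, u, x) and (y, x, e).\<close>
  have c: "ract XE aE bs = 0" "ract YU aU bs = 0" "ract YU aX bs = 0"
    "ract YX aE bs = YX bs + lmul aY (XE bs)" for bs
    unfolding defs by (simp_all add: cocycle3[OF F(2)] U E z)
  \<comment> \<open>At (y, x) the equation is yg + hx = \<open>YX\<close>. With the choices of
    \<open>g\<close> and \<open>h\<close> below and \<open>YU\<close> x = 0 it becomes
    \<open>\<phi>\<close> x = \<open>YX\<close> + y \<open>XE\<close>, and by \<open>c\<close> the
    right side is \<open>YX\<close> e.\<close>
  define \<psi> where "\<psi> = ract YX aE"
  have e\<psi>: "lmul aE (\<psi> bs) = \<psi> bs" for bs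
    unfolding \<psi>_def by (simp flip: ract_linear(5)) (simp add: YX_def EF)
  have "ract \<psi> aE = \<psi>"
    by (simp add: \<psi>_def ract_ract fun_eq_iff)
  with e\<psi> obtain \<phi> where \<phi>: "multilinear \<phi>" "\<And>bs. lmul aE (\<phi> bs) = \<phi> bs" "ract \<phi> aU = \<phi>" "ract \<phi> aX = \<psi>"
    using ract_aX_surj[of \<psi>] multilinear_ract[OF ml(4)] \<psi>_def by metis
  \<comment> \<open>At (x, e) the differential is ge - g, and \<open>XE\<close> e = 0. At (y, u) it
    is hu - h, where \<open>\<phi>\<close> u = \<open>\<phi>\<close> and \<open>YU\<close> u = 0.
    Finally \<open>k\<close> solves xh - k + gy = \<open>XY\<close>.\<close>
  define g where "g = - XE"
  define h where "h = \<phi> - YU"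
  define k where "k = (\<lambda>bs. lmul aX (h bs)) + ract g aY - XY"
  define G where "G = extend g h k"
  have mlg: "multilinear g" "multilinear h" "multilinear k"
    unfolding g_def h_def k_def by (intro multilinear_closed multilinear_ract ml \<phi>(1))+
  have G: "multilinear G"
    unfolding G_def by (rule multilinear_extend[OF mlg])
  have G_Cons: "(\<lambda>cs. G (aU # cs)) = 0" "(\<lambda>cs. G (aE # cs)) = 0" "(\<lambda>cs. G (aX # cs)) = g"
    "(\<lambda>cs. G (aY # cs)) = h"
    by (simp_all add: G_def fun_eq_iff)
  have g: "lmul aU (g bs) = g bs" "lmul aE (g bs) = 0" for bs
    by (simp_all add: g_def XE_def lmul_linear UF EF z)
  have h: "lmul aE (h bs) = h bs" "lmul aU (h bs) = 0" for bs
  proof -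
    show *: "lmul aE (h bs) = h bs" by (simp add: h_def YU_def lmul_linear EF \<phi>)
    show "lmul aU (h bs) = 0" by (subst *[symmetric]) (simp add: lmul_lmul)
  qed
  have k: "lmul aU (k bs) = k bs" "lmul aE (k bs) = 0" for bs
    by (simp_all add: k_def XY_def lmul_linear UF EF lmul_lmul flip: ract_linear(5))
      (simp_all add: g z)
  \<comment> \<open>This equivariance makes \<open>delta G\<close> vanish when its first argument is
    u or e.\<close>
  have GU: "lmul aU (G (b # bs)) = G (aU \<star> b # bs)" and GE: "lmul aE (G (b # bs)) = G (aE \<star> b # bs)" for b bs
    by (cases b; simp add: G_def basis_defs zero_prod_def; simp flip: basis_defs add: lmul_linear g h k)+
  define D where "D = F - delta G"
  have "D = 0"
  proof (rule cocycle_eq_zero)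
    show "multilinear D" unfolding D_def by (intro multilinear_closed multilinear_delta F G)
    show "delta D = 0" by (simp add: D_def delta_linear delta_delta F)
    show "D [] = 0" "D [a] = 0" for a
      by (simp_all add: D_def F0 G_def)
    show "D (aU # a # bs) = 0" "D (aE # a # bs) = 0" for a bs
      by (simp_all add: D_def U E delta_Cons2 G_Cons GU GE ract_zero_fun del: delta.simps)
    show "D (aX # aE # bs) = 0" "D (aX # aY # bs) = 0" "D (aY # aU # bs) = 0" "D (aY # aX # bs) = 0" for bs
      by (simp_all add: D_def delta_Cons2 G_Cons del: delta.simps)
        (simp_all add: G_def g_def k_def h_def c \<phi> \<psi>_def ract_linear lmul_linear,
          simp_all add: defs)
  qed
  then show ?thesis
    using that[OF G] by (simp add: D_def)
qed

lemma cocycle_exact: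
  fixes F :: "'r::comm_ring_1 coch"
  assumes F: "multilinear F" "delta F = 0" and F0: "F [] = 0" "\<And>a. F [a] = 0"
  obtains G where "multilinear G" "delta G = F"
proof -
  obtain G where G: "multilinear G" "G [] = 0"
    "\<And>bs. (F - delta G) (aU # bs) = 0" "\<And>bs. (F - delta G) (aE # bs) = 0"
    using cocycle_normalise[OF F F0] by blast
  obtain H where "multilinear H" "delta H = F - delta G"
  proof (rule normalised_cocycle_exact[of "F - delta G"])
    show "multilinear (F - delta G)" by (intro multilinear_closed multilinear_delta F G)
    show "delta (F - delta G) = 0" by (simp add: delta_linear delta_delta F)
    show "(F - delta G) [] = 0" "(F - delta G) [a] = 0" for a
      by (simp_all add: F0 G)
    show "(F - delta G) (aU # bs) = 0" "(F - delta G) (aE # bs) = 0" for bs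
      by (fact G)+
  qed
  then show ?thesis
    using that[of "G + H"] multilinear_add_fun[OF G(1), of H] by (simp add: delta_linear)
qed

section \<open>Comparison with the Hochschild complex of matrices\<close>

definition alg_of :: "'r::comm_ring_1 mat \<Rightarrow> 'r alg" where
  "alg_of X = (X $$ (0,0), X $$ (0,1), X $$ (0,2), X $$ (1,2), X $$ (1,1))"

fun mat_of_alg :: "'r::comm_ring_1 alg \<Rightarrow> 'r mat" where
  "mat_of_alg (a, b, c, d, e) = mat 3 3 (\<lambda>(i, j). [[a, b, c], [0, e, d], [0, 0, a]] ! i ! j)"

text \<open>The coordinates are the linear forms whose common kernel is \<open>S11\<close>, so they
  separate classes.\<close>

definition quot_of :: "'r::comm_ring_1 mat \<Rightarrow> 'r quot" where
  "quot_of X = (X $$ (1,0), X $$ (2,0), X $$ (2,1), X $$ (0,0) - X $$ (2,2))"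

fun mat_of_quot :: "'r::comm_ring_1 quot \<Rightarrow> 'r mat" where
  "mat_of_quot (p, w, q, f) = mat 3 3 (\<lambda>(i, j). [[f, 0, 0], [p, 0, 0], [w, q, 0]] ! i ! j)"

lemma less_3_cases: "i < 3 \<Longrightarrow> i = 0 \<or> i = 1 \<or> i = (2::nat)"
  by auto

lemma index_mult_mat3:
  assumes "X \<in> carrier_mat 3 3" "Y \<in> carrier_mat 3 3" "i < 3" "j < 3"
  shows "(X * Y) $$ (i, j) = X $$ (i, 0) * Y $$ (0, j) + X $$ (i, 1) * Y $$ (1, j) + X $$ (i, 2) * Y $$ (2, j)"
  using assms by (auto simp: scalar_prod_def numeral_3_eq_3 numeral_2_eq_2)

lemma S11_carrier: "X \<in> S11 \<Longrightarrow> X \<in> carrier_mat 3 3"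
  by (simp add: S11_def)

lemma S11_add: "X \<in> S11 \<Longrightarrow> Y \<in> S11 \<Longrightarrow> X + Y \<in> S11"
  and S11_smult: "X \<in> S11 \<Longrightarrow> r \<cdot>\<^sub>m X \<in> S11"
  and S11_mult: "X \<in> S11 \<Longrightarrow> Y \<in> S11 \<Longrightarrow> X * Y \<in> S11"
  by (auto simp: S11_def index_mult_mat3 mult.commute)

lemmas S11_closed = S11_add S11_smult S11_mult

lemma alg_of_add: "X \<in> S11 \<Longrightarrow> Y \<in> S11 \<Longrightarrow> alg_of (X + Y) = alg_of X + alg_of Y"
  and alg_of_smult: "X \<in> S11 \<Longrightarrow> alg_of (r \<cdot>\<^sub>m X) = ascale r (alg_of X)"
  and alg_of_mult: "X \<in> S11 \<Longrightarrow> Y \<in> S11 \<Longrightarrow> alg_of (X * Y) = alg_of X \<star> alg_of Y"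
  by (auto simp: S11_def alg_of_def index_mult_mat3)

lemmas alg_of_ops = alg_of_add alg_of_smult alg_of_mult

lemma mat_of_alg_S11 [simp]: "mat_of_alg a \<in> S11"
  by (cases a) (simp add: S11_def)

lemma alg_of_mat_of_alg [simp]: "alg_of (mat_of_alg a) = a"
  by (cases a) (simp add: alg_of_def)

lemma mat_of_alg_of: "X \<in> S11 \<Longrightarrow> mat_of_alg (alg_of X) = X"
  by (rule eq_matI) (auto simp: S11_def alg_of_def dest!: less_3_cases)

lemma mat_of_alg_eqI: "X \<in> S11 \<Longrightarrow> alg_of X = a \<Longrightarrow> mat_of_alg a = X"
  using mat_of_alg_of by blast

lemma mat_of_alg_add: "mat_of_alg (a + b) = mat_of_alg a + mat_of_alg b"
  and mat_of_alg_smult: "mat_of_alg (ascale r a) = r \<cdot>\<^sub>m mat_of_alg a"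
  by (intro mat_of_alg_eqI S11_closed mat_of_alg_S11, simp only: alg_of_ops mat_of_alg_S11 alg_of_mat_of_alg)+

lemma mat_of_quot_carrier [simp]: "mat_of_quot m \<in> carrier_mat 3 3"
  by (cases m) simp

lemma quot_of_mat_of_quot [simp]: "quot_of (mat_of_quot m) = m"
  by (cases m) (simp add: quot_of_def)

lemma quot_of_add:
    "X \<in> carrier_mat 3 3 \<Longrightarrow> Y \<in> carrier_mat 3 3 \<Longrightarrow> quot_of (X + Y) = quot_of X + quot_of Y"
  and quot_of_smult: "X \<in> carrier_mat 3 3 \<Longrightarrow> quot_of (r \<cdot>\<^sub>m X) = mscale r (quot_of X)"
  and quot_of_lmul: "X \<in> carrier_mat 3 3 \<Longrightarrow> A \<in> S11 \<Longrightarrow> quot_of (A * X) = lmul (alg_of A) (quot_of X)"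
  and quot_of_rmul: "X \<in> carrier_mat 3 3 \<Longrightarrow> A \<in> S11 \<Longrightarrow> quot_of (X * A) = rmul (quot_of X) (alg_of A)"
  by (auto simp: S11_def alg_of_def quot_of_def index_mult_mat3 algebra_simps)

lemma mem_qcls_iff:
  assumes "X \<in> carrier_mat 3 3"
  shows "Y \<in> qcls X \<longleftrightarrow> Y \<in> carrier_mat 3 3 \<and> quot_of Y = quot_of X"
  using assms by (auto simp: qcls_def S11_def quot_of_def algebra_simps)

text \<open>The choice made by \<open>qrep\<close> is invisible in coordinates; hence the operations
  on classes, which are defined through representatives, become coordinate formulas.\<close>

lemma qrep_qcls:
  assumes "X \<in> carrier_mat 3 3"
  shows "qrep (qcls X) \<in> carrier_mat 3 3" "quot_of (qrep (qcls X)) = quot_of X"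
proof -
  have "qrep (qcls X) \<in> qcls X"
    unfolding qrep_def by (rule someI[of _ X]) (simp add: mem_qcls_iff assms)
  then show "qrep (qcls X) \<in> carrier_mat 3 3" "quot_of (qrep (qcls X)) = quot_of X"
    by (simp_all add: mem_qcls_iff assms)
qed

definition coords :: "'r::comm_ring_1 mat set \<Rightarrow> 'r quot" where
  "coords C = quot_of (qrep C)"

definition of_coords :: "'r::comm_ring_1 quot \<Rightarrow> 'r mat set" where
  "of_coords m = qcls (mat_of_quot m)"

lemma coords_qcls: "X \<in> carrier_mat 3 3 \<Longrightarrow> coords (qcls X) = quot_of X"
  by (simp add: coords_def qrep_qcls)

lemma coords_of_coords [simp]: "coords (of_coords m) = m"
  by (simp add: of_coords_def coords_qcls)

lemma of_coords_Q [simp]: "of_coords m \<in> Q"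
  by (simp add: of_coords_def Q_def)

lemma of_coords_coords: "C \<in> Q \<Longrightarrow> of_coords (coords C) = C"
  unfolding Q_def of_coords_def by (auto simp: coords_qcls mem_qcls_iff)

lemma qrep_carrier: "C \<in> Q \<Longrightarrow> qrep C \<in> carrier_mat 3 3"
  unfolding Q_def by (auto simp: qrep_qcls)

lemma qcls_Q: "X \<in> carrier_mat 3 3 \<Longrightarrow> qcls X \<in> Q"
  by (simp add: Q_def)

lemma quot_of_qrep_of_coords [simp]: "quot_of (qrep (of_coords m)) = m"
  by (simp add: of_coords_def qrep_qcls)

lemma qrep_of_coords_carrier [simp]: "qrep (of_coords m) \<in> carrier_mat 3 3"
  by (simp add: qrep_carrier)

lemma qcls_eq: "X \<in> carrier_mat 3 3 \<Longrightarrow> qcls X = of_coords (quot_of X)"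
  using of_coords_coords[OF qcls_Q, of X] by (simp add: coords_qcls)

lemma qzero_eq: "qzero = of_coords 0"
  by (simp add: qzero_def qcls_eq) (simp add: quot_of_def zero_prod_def)

lemma qadd_of_coords: "qadd (of_coords m) (of_coords m') = of_coords (m + m')"
  by (simp add: qadd_def qcls_eq quot_of_add)

lemma qsmult_of_coords: "qsmult r (of_coords m) = of_coords (mscale r m)"
  by (simp add: qsmult_def qcls_eq quot_of_smult)

lemma qact_of_coords:
  assumes "A \<in> S11"
  shows "qlact A (of_coords m) = of_coords (lmul (alg_of A) m)"
    "qract (of_coords m) A = of_coords (rmul m (alg_of A))"
proof -
  have "A * X \<in> carrier_mat 3 3" "X * A \<in> carrier_mat 3 3" if "X \<in> carrier_mat 3 3" for X
    using S11_carrier[OF assms] that by (auto intro: mult_carrier_mat)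
  then show "qlact A (of_coords m) = of_coords (lmul (alg_of A) m)"
    "qract (of_coords m) A = of_coords (rmul m (alg_of A))"
    by (simp_all add: qlact_def qract_def qcls_eq quot_of_lmul quot_of_rmul assms)
qed

lemma qsum_of_coords: "qsum (map of_coords ms) = of_coords (sum_list ms)"
  by (induction ms) (simp_all add: qsum_def qzero_eq qadd_of_coords)

section \<open>Cochains on matrices and cochains in coordinates\<close>

text \<open>Singles out the cochains of one degree among the functions on all lists. Zero outside
  that degree, in place of \<open>undefined\<close>, keeps them closed under pointwise
  operations.\<close>

definition supported :: "nat \<Rightarrow> 'r::comm_ring_1 coch \<Rightarrow> bool" where
  "supported n F \<longleftrightarrow> (\<forall>xs. length xs \<noteq> n \<longrightarrow> F xs = 0)"

definition to_coch :: "nat \<Rightarrow> ('r::comm_ring_1 mat list \<Rightarrow> 'r mat set) \<Rightarrow> 'r coch" where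
  "to_coch n f xs = (if length xs = n then coords (f (map mat_of_alg xs)) else 0)"

definition of_coch :: "nat \<Rightarrow> 'r::comm_ring_1 coch \<Rightarrow> 'r mat list \<Rightarrow> 'r mat set" where
  "of_coch n F xs = (if cdom n xs then of_coords (F (map alg_of xs)) else undefined)"

lemma cdom_map_mat_of_alg [simp]: "cdom n (map mat_of_alg xs) \<longleftrightarrow> length xs = n"
  by (simp add: cdom_def image_subset_iff)

lemma map_alg_of_mat_of_alg [simp]: "map alg_of (map mat_of_alg xs) = xs"
  by (induction xs) simp_all

lemma map_mat_of_alg_of: "cdom n xs \<Longrightarrow> map mat_of_alg (map alg_of xs) = xs"
  by (auto simp: cdom_def mat_of_alg_of map_idI subset_iff)

lemma supported_to_coch [simp]: "supported n (to_coch n f)"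
  by (simp add: supported_def to_coch_def)

lemma to_coch_of_coch: "to_coch n (of_coch n F) xs = (if length xs = n then F xs else 0)"
  by (simp add: to_coch_def of_coch_def del: map_map)

lemma to_coch_of_coch_supported: "supported n F \<Longrightarrow> to_coch n (of_coch n F) = F"
  by (auto simp: fun_eq_iff to_coch_of_coch supported_def)

lemma of_coch_to_coch: "cochain n f \<Longrightarrow> of_coch n (to_coch n f) = f"
proof
  fix xs
  assume f: "cochain n f"
  show "of_coch n (to_coch n f) xs = f xs"
  proof (cases "cdom n xs")
    case True
    then have "length xs = n" by (simp add: cdom_def)
    moreover have "f xs \<in> Q" using f True by (simp add: cochain_def)
    ultimately show ?thesis
      using True by (simp add: of_coch_def to_coch_def map_mat_of_alg_of of_coords_coords del: map_map)
  next
    case False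
    then show ?thesis using f by (simp add: of_coch_def cochain_def)
  qed
qed

lemma multilinear_to_coch:
  assumes "cochain n f"
  shows "multilinear (to_coch n f)"
  unfolding multilinear_def
proof (intro allI)
  fix as bs :: "'a alg list" and a b r
  show "to_coch n f (as @ (a + b) # bs) = to_coch n f (as @ a # bs) + to_coch n f (as @ b # bs) \<and>
      to_coch n f (as @ ascale r a # bs) = mscale r (to_coch n f (as @ a # bs))"
  proof (cases "length as + Suc (length bs) = n")
    case True
    define xs where "xs = map mat_of_alg (as @ a # bs)"
    \<comment> \<open>\<open>cochain\<close> expresses linearity by list update,
      \<open>multilinear\<close> by concatenation; this equation links them.\<close>
    have upd: "xs[length as := X] = map mat_of_alg as @ X # map mat_of_alg bs" for X
      using list_update_length[of "map mat_of_alg as"] by (simp add: xs_def)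
    have xs: "cdom n xs" "length as < n" using True by (auto simp: xs_def simp del: map_append list.map)
    have Qf: "f (xs[length as := mat_of_alg c]) \<in> Q" for c
    proof -
      have "cdom n (map mat_of_alg (as @ c # bs))"
        using True by (simp only: cdom_map_mat_of_alg) simp
      then show ?thesis using assms by (simp add: upd cochain_def)
    qed
    have lin: "f (xs[length as := y + z]) = qadd (f (xs[length as := y])) (f (xs[length as := z]))"
      "f (xs[length as := r \<cdot>\<^sub>m y]) = qsmult r (f (xs[length as := y]))"
      if "y \<in> S11" "z \<in> S11" for y z
      using assms xs that unfolding cochain_def by blast+
    define v where "v c = coords (f (xs[length as := mat_of_alg c]))" for c
    have v: "f (xs[length as := mat_of_alg c]) = of_coords (v c)" for c
      unfolding v_def using Qf by (simp add: of_coords_coords)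
    have "v (a + b) = v a + v b" "v (ascale r a) = mscale r (v a)"
      unfolding v_def[of "a + b"] v_def[of "ascale r a"] mat_of_alg_add mat_of_alg_smult
        lin(1)[OF mat_of_alg_S11 mat_of_alg_S11] lin(2)[OF mat_of_alg_S11 mat_of_alg_S11] v
      by (simp_all only: qadd_of_coords qsmult_of_coords coords_of_coords)
    then show ?thesis
      using True by (simp add: to_coch_def v_def upd)
  qed (simp add: to_coch_def)
qed

lemma cochain_of_coch:
  assumes "multilinear F"
  shows "cochain n (of_coch n F)"
  unfolding cochain_def
proof (intro conjI allI impI)
  fix xs :: "'a mat list" and i r and y z :: "'a mat"
  assume A: "cdom n xs \<and> i < n \<and> y \<in> S11 \<and> z \<in> S11"
  have upd: "map alg_of (xs[i := X]) = take i (map alg_of xs) @ alg_of X # drop (Suc i) (map alg_of xs)" for X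
    using A by (simp add: cdom_def map_update upd_conv_take_nth_drop take_map drop_map)
  have dom: "cdom n (xs[i := X])" if "X \<in> S11" for X
    using A that set_update_subset_insert[of xs i X] by (auto simp: cdom_def)
  show "of_coch n F (xs[i := y + z]) = qadd (of_coch n F (xs[i := y])) (of_coch n F (xs[i := z]))"
    "of_coch n F (xs[i := r \<cdot>\<^sub>m y]) = qsmult r (of_coch n F (xs[i := y]))"
    using A by (simp_all add: of_coch_def dom S11_closed upd alg_of_ops multilinear_add[OF assms]
        multilinear_scale[OF assms] qadd_of_coords qsmult_of_coords)
qed (simp_all add: of_coch_def)

section \<open>Agreement of the two differentials\<close>

lemma ract_cong: "(\<And>xs. length xs = length bs \<Longrightarrow> F xs = G xs) \<Longrightarrow> ract F a bs = ract G a bs"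
proof (induction bs arbitrary: F G a)
  case (Cons b bs)
  have "ract (\<lambda>cs. F (a # cs)) b bs = ract (\<lambda>cs. G (a # cs)) b bs"
    by (rule Cons.IH) (simp add: Cons.prems)
  then show ?case by (simp add: Cons.prems)
qed simp

lemma delta_cong:
  assumes "\<And>ys. Suc (length ys) = length xs \<Longrightarrow> F ys = G ys"
  shows "delta F xs = delta G xs"
proof (cases xs)
  case (Cons a bs)
  have "ract F a bs = ract G a bs" by (rule ract_cong) (simp add: assms Cons)
  then show ?thesis by (simp add: assms Cons)
qed simp

lemma supported_delta:
  assumes "supported n F"
  shows "supported (Suc n) (delta F)"
  unfolding supported_def
proof (intro allI impI)
  fix xs :: "'a alg list"
  assume "length xs \<noteq> Suc n"
  then have "delta F xs = delta 0 xs"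
    using assms by (intro delta_cong) (auto simp: supported_def)
  then show "delta F xs = 0" by (simp add: delta_linear)
qed

text \<open>Unrolling the recursion gives the terms of the Hochschild differential other than the
  first, with opposite signs, in accordance with the minus sign before \<open>ract\<close> in
  \<open>delta\<close>.\<close>

lemma ract_eq_sum:
  "ract F a bs = (\<Sum>i<length bs. mscale ((-1) ^ i)
       (F (take i (a # bs) @ [(a # bs) ! i \<star> (a # bs) ! Suc i] @ drop (Suc (Suc i)) (a # bs))))
     + mscale ((-1) ^ length bs) (rmul (F (take (length bs) (a # bs))) ((a # bs) ! length bs))"
proof (induction bs arbitrary: F a)
  case Nil
  show ?case by simp
next
  case (Cons b bs)
  show ?case
    by (simp add: Cons.IH sum.lessThan_Suc_shift mscale_minus_left sum_negf del: sum.lessThan_Suc)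
qed

lemma delta_eq_sum_list:
  assumes "length xs = Suc n"
  shows "delta F xs = sum_list ([lmul (hd xs) (F (tl xs))]
     @ map (\<lambda>i. mscale ((-1) ^ Suc i) (F (take i xs @ [xs ! i \<star> xs ! Suc i] @ drop (Suc (Suc i)) xs))) [0..<n]
     @ [mscale ((-1) ^ Suc n) (rmul (F (take n xs)) (xs ! n))])"
proof -
  obtain a bs where xs: "xs = a # bs" "length bs = n"
    using assms by (cases xs) auto
  show ?thesis
    by (simp add: xs ract_eq_sum mscale_minus_left interv_sum_list_conv_sum_set_nat sum_negf lessThan_atLeast0)
qed

lemma hdiff_of_coch:
  "hdiff n (of_coch n F) = of_coch (Suc n) (delta F)"
proof
  fix xs :: "'a mat list"
  show "hdiff n (of_coch n F) xs = of_coch (Suc n) (delta F) xs"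
  proof (cases "cdom (Suc n) xs")
    case True
    then have len: "length xs = Suc n" and sub: "set xs \<subseteq> S11" by (simp_all add: cdom_def)
    have mem: "xs ! i \<in> S11" if "i < Suc n" for i using len sub that by auto
    have hd: "hd xs \<in> S11" "alg_of (hd xs) = hd (map alg_of xs)"
      using len sub by (cases xs; simp)+
    have tl: "cdom n (tl xs)" using len sub by (cases xs) (simp_all add: cdom_def)
    have tk: "cdom n (take n xs)" using len sub set_take_subset[of n xs] by (auto simp: cdom_def)
    have mid: "cdom n (take i xs @ [xs ! i * xs ! Suc i] @ drop (Suc (Suc i)) xs)" if "i < n" for i
      using len sub that set_take_subset[of i xs] set_drop_subset[of "Suc (Suc i)" xs] mem
      by (auto simp: cdom_def intro!: S11_closed)
    let ?ys = "map alg_of xs"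
    have *: "qsmult r (of_coch n F (take i xs @ [xs ! i * xs ! Suc i] @ drop (Suc (Suc i)) xs)) =
      of_coords (mscale r (F (take i ?ys @ [?ys ! i \<star> ?ys ! Suc i] @ drop (Suc (Suc i)) ?ys)))"
      if "i < n" for i r
      using that by (simp add: of_coch_def mid[simplified] qsmult_of_coords take_map drop_map
          alg_of_mult mem len)
    have mid': "map (\<lambda>i. qsmult ((-1) ^ Suc i)
          (of_coch n F (take i xs @ [xs ! i * xs ! Suc i] @ drop (Suc (Suc i)) xs))) [0..<n] =
        map of_coords (map (\<lambda>i. mscale ((-1) ^ Suc i)
          (F (take i ?ys @ [?ys ! i \<star> ?ys ! Suc i] @ drop (Suc (Suc i)) ?ys))) [0..<n])"
      unfolding map_map o_def by (intro map_cong refl *) simp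
    have first: "qlact (hd xs) (of_coch n F (tl xs)) = of_coords (lmul (hd ?ys) (F (tl ?ys)))"
      by (simp add: of_coch_def tl hd qact_of_coords map_tl)
    have last: "qsmult r (qract (of_coch n F (take n xs)) (xs ! n)) =
        of_coords (mscale r (rmul (F (take n ?ys)) (?ys ! n)))" for r
      by (simp add: of_coch_def tk mem len qact_of_coords qsmult_of_coords take_map)
    have "hdiff n (of_coch n F) xs = qsum (map of_coords ([lmul (hd ?ys) (F (tl ?ys))]
     @ map (\<lambda>i. mscale ((-1) ^ Suc i) (F (take i ?ys @ [?ys ! i \<star> ?ys ! Suc i] @ drop (Suc (Suc i)) ?ys))) [0..<n]
     @ [mscale ((-1) ^ Suc n) (rmul (F (take n ?ys)) (?ys ! n))]))"
      by (simp only: hdiff_def True if_True mid' first last map_append list.map)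
    also have "\<dots> = of_coords (delta F ?ys)"
      by (subst qsum_of_coords, subst delta_eq_sum_list[of _ n]) (simp_all add: len)
    finally show ?thesis using True by (simp add: of_coch_def)
  qed (simp add: hdiff_def of_coch_def)
qed

lemma czero_eq: "czero n = of_coch n 0"
  by (simp add: fun_eq_iff czero_def of_coch_def qzero_eq)

lemma of_coch_eq_iff:
  assumes "supported n F" "supported n G"
  shows "of_coch n F = of_coch n G \<longleftrightarrow> F = G"
  using assms to_coch_of_coch_supported by metis

lemma supported_zero: "supported n 0"
  by (simp add: supported_def)

section \<open>Cohomology classes as fibres of a linear functional\<close>

definition cocycles :: "nat \<Rightarrow> 'r::comm_ring_1 coch set" where
  "cocycles n = {F. multilinear F \<and> supported n F \<and> delta F = 0}"

lemma ZZ_eq: "ZZ n = of_coch n ` cocycles n"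
proof -
  have *: "hdiff n (of_coch n F) = czero (Suc n) \<longleftrightarrow> delta F = 0" if "supported n F" for F
    unfolding hdiff_of_coch czero_eq by (rule of_coch_eq_iff[OF supported_delta[OF that] supported_zero])
  show ?thesis
  proof (intro equalityI subsetI)
    fix f assume "f \<in> ZZ n"
    then have "f = of_coch n (to_coch n f)" "to_coch n f \<in> cocycles n"
      using *[OF supported_to_coch, of f] by (simp_all add: ZZ_def cocycles_def multilinear_to_coch of_coch_to_coch)
    then show "f \<in> of_coch n ` cocycles n" by blast
  next
    fix f assume "f \<in> of_coch n ` cocycles n"
    then show "f \<in> ZZ n" by (auto simp: ZZ_def cocycles_def * cochain_of_coch)
  qed
qed

lemma BB_0: "BB 0 = of_coch 0 ` {0}"
  by (simp add: BB_def czero_eq)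

lemma BB_Suc: "BB (Suc n) = of_coch (Suc n) ` {delta G |G. multilinear G \<and> supported n G}"
proof (intro equalityI subsetI)
  fix f assume "f \<in> BB (Suc n)"
  then obtain g where "cochain n g" "f = hdiff n g" by (auto simp: BB_def)
  then have "f = of_coch (Suc n) (delta (to_coch n g))" "multilinear (to_coch n g)"
    by (simp_all flip: hdiff_of_coch add: of_coch_to_coch multilinear_to_coch)
  then show "f \<in> of_coch (Suc n) ` {delta G |G. multilinear G \<and> supported n G}" by force
next
  fix f assume "f \<in> of_coch (Suc n) ` {delta G |G. multilinear G \<and> supported n G}"
  then show "f \<in> BB (Suc n)" by (auto simp: BB_def cochain_of_coch simp flip: hdiff_of_coch)
qed

lemma cadd_of_coch: "cadd n (of_coch n F) (of_coch n G) = of_coch n (F + G)"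
  by (simp add: fun_eq_iff cadd_def of_coch_def qadd_of_coords)

lemma csmult_of_coch: "csmult n r (of_coch n F) = of_coch n (\<lambda>xs. mscale r (F xs))"
  by (simp add: fun_eq_iff csmult_def of_coch_def qsmult_of_coords)

lemma cocycles_closed:
  assumes "F \<in> cocycles n" "G \<in> cocycles n"
  shows "F + G \<in> cocycles n" "F - G \<in> cocycles n" "(\<lambda>xs. mscale r (F xs)) \<in> cocycles n"
  using assms by (auto simp: cocycles_def multilinear_closed delta_linear supported_def)

text \<open>If the coboundaries are the kernel of an additive map on the cocycles, then their cosets
  are its fibres.\<close>

lemma hcls_of_coch:
  fixes T :: "'r::comm_ring_1 coch \<Rightarrow> 'r"
  assumes T: "\<And>F G. T (F + G) = T F + T G"
    and BB: "BB n = of_coch n ` {B \<in> cocycles n. T B = 0}"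
    and F: "F \<in> cocycles n"
  shows "hcls n (of_coch n F) = of_coch n ` {G \<in> cocycles n. T G = T F}"
proof -
  have "hcls n (of_coch n F) = of_coch n ` (\<lambda>B. F + B) ` {B \<in> cocycles n. T B = 0}"
    unfolding hcls_def BB by (simp add: Setcompr_eq_image image_image cadd_of_coch)
  also have "(\<lambda>B. F + B) ` {B \<in> cocycles n. T B = 0} = {G \<in> cocycles n. T G = T F}"
  proof (intro equalityI subsetI)
    fix G assume G: "G \<in> {G \<in> cocycles n. T G = T F}"
    then have "T F + T (G - F) = T F" by (simp flip: T)
    with G F have "G - F \<in> {B \<in> cocycles n. T B = 0}" by (simp add: cocycles_closed)
    then show "G \<in> (\<lambda>B. F + B) ` {B \<in> cocycles n. T B = 0}"
      by (intro image_eqI[of _ _ "G - F"]) simp_all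
  qed (auto simp: T cocycles_closed F)
  finally show ?thesis .
qed

text \<open>The first isomorphism theorem for \<open>T\<close>, which reduces a degree to finding a
  surjective functional whose kernel is the coboundaries.\<close>

lemma HH_iso:
  fixes T :: "'r::comm_ring_1 coch \<Rightarrow> 'r"
  assumes T: "\<And>F G. T (F + G) = T F + T G" "\<And>r F. T (\<lambda>xs. mscale r (F xs)) = r * T F"
    and BB: "BB n = of_coch n ` {B \<in> cocycles n. T B = 0}"
    and surj: "\<And>r. \<exists>F \<in> cocycles n. T F = r"
  shows "\<exists>\<psi>. bij_betw \<psi> (HH n) (UNIV :: 'r set) \<and>
           (\<forall>f\<in>ZZ n. \<forall>g\<in>ZZ n. \<psi> (hcls n (cadd n f g)) = \<psi> (hcls n f) + \<psi> (hcls n g)) \<and>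
           (\<forall>f\<in>ZZ n. \<forall>r. \<psi> (hcls n (csmult n r f)) = r * \<psi> (hcls n f))"
proof -
  note hcls = hcls_of_coch[of T, OF T(1) BB]
  define \<psi> where "\<psi> C = T (to_coch n (SOME f. f \<in> C))" for C
  have \<psi>: "\<psi> (hcls n (of_coch n F)) = T F" if F: "F \<in> cocycles n" for F
  proof -
    have "of_coch n F \<in> hcls n (of_coch n F)" using F by (simp add: hcls)
    then have "(SOME f. f \<in> hcls n (of_coch n F)) \<in> hcls n (of_coch n F)"
      by (rule someI[where P = "\<lambda>f. f \<in> hcls n (of_coch n F)"])
    then obtain G where "G \<in> cocycles n" "T G = T F" "(SOME f. f \<in> hcls n (of_coch n F)) = of_coch n G"
      by (auto simp: hcls[OF F])
    then show ?thesis by (simp add: \<psi>_def to_coch_of_coch_supported cocycles_def)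
  qed
  have HH: "HH n = (\<lambda>F. hcls n (of_coch n F)) ` cocycles n"
    by (simp add: HH_def ZZ_eq image_image)
  have "bij_betw \<psi> (HH n) UNIV"
    unfolding bij_betw_def
  proof
    show "inj_on \<psi> (HH n)"
    proof (rule inj_onI)
      fix C D assume "C \<in> HH n" "D \<in> HH n" "\<psi> C = \<psi> D"
      then obtain F G where "F \<in> cocycles n" "C = hcls n (of_coch n F)"
        "G \<in> cocycles n" "D = hcls n (of_coch n G)" "T F = T G" by (auto simp: HH \<psi>)
      then show "C = D" by (simp only: hcls)
    qed
    have "r \<in> \<psi> ` HH n" for r
    proof -
      obtain F where "F \<in> cocycles n" "T F = r" using surj by blast
      then show ?thesis unfolding HH by (auto intro!: image_eqI[where x = F] simp: image_image \<psi>)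
    qed
    then show "\<psi> ` HH n = UNIV" by blast
  qed
  then show ?thesis
    by (intro exI[of _ \<psi>]) (simp add: ZZ_eq cadd_of_coch csmult_of_coch \<psi> cocycles_closed T)
qed

section \<open>The cohomology groups\<close>

lemma delta_eq_zero_iff_0:
  assumes "supported 0 F"
  shows "delta F = 0 \<longleftrightarrow> (\<forall>a. lmul a (F []) = rmul (F []) a)"
proof
  assume "delta F = 0"
  then have "delta F [a] = 0" for a by simp
  then show "\<forall>a. lmul a (F []) = rmul (F []) a" by simp
next
  assume "\<forall>a. lmul a (F []) = rmul (F []) a"
  then have "delta F [a] = 0" for a by simp
  then have "delta F xs = 0" for xs
    using supported_delta[OF assms] by (cases "length xs = 1") (auto simp: length_Suc_conv supported_def)
  then show "delta F = 0" by (simp add: fun_eq_iff)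
qed

text \<open>Commuting with u kills the coordinates at E21 and E32, commuting with x the one at E31.
  On the class of E11 both actions are multiplication by the corner entry of
  \<open>a\<close>.\<close>

lemma centre_iff: "(\<forall>a. lmul a m = rmul m a) \<longleftrightarrow> (\<exists>r. m = (0, 0, 0, r :: 'r::comm_ring_1))"
proof
  assume *: "\<forall>a. lmul a m = rmul m a"
  show "\<exists>r. m = (0, 0, 0, r)"
    using *[rule_format, of aU] *[rule_format, of aX] *[rule_format, of aE]
    by (cases m) (simp add: basis_defs)
qed (auto simp: mult.commute)

lemma HH_0:
  "\<exists>\<psi>. bij_betw \<psi> (HH 0) (UNIV :: 'r::comm_ring_1 set) \<and>
           (\<forall>f\<in>ZZ 0. \<forall>g\<in>ZZ 0. \<psi> (hcls 0 (cadd 0 f g)) = \<psi> (hcls 0 f) + \<psi> (hcls 0 g)) \<and>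
           (\<forall>f\<in>ZZ 0. \<forall>r. \<psi> (hcls 0 (csmult 0 r f)) = r * \<psi> (hcls 0 f))"
proof (rule HH_iso[where T = "\<lambda>F. snd (snd (snd (F [])))"])
  fix F G :: "'r coch" and r :: 'r
  show "snd (snd (snd ((F + G) []))) = snd (snd (snd (F []))) + snd (snd (snd (G [])))" by simp
  show "snd (snd (snd (mscale r (F [])))) = r * snd (snd (snd (F [])))"
    by (cases "F []") simp
  define F0 :: "'r coch" where "F0 = (\<lambda>xs. if xs = [] then (0, 0, 0, r) else 0)"
  have F0: "multilinear F0" "supported 0 F0"
    by (simp_all add: F0_def multilinear_def supported_def)
  moreover have "delta F0 = 0"
    unfolding delta_eq_zero_iff_0[OF F0(2)] centre_iff by (simp add: F0_def)
  ultimately show "\<exists>F\<in>cocycles 0. snd (snd (snd (F []))) = r"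
    by (intro bexI[of _ F0]) (simp_all add: cocycles_def F0_def)
next
  have "{B \<in> cocycles 0. snd (snd (snd (B []))) = (0 :: 'r)} = {0}"
  proof (intro equalityI subsetI)
    fix B :: "'r coch"
    assume B: "B \<in> {B \<in> cocycles 0. snd (snd (snd (B []))) = 0}"
    then have "supported 0 B" "B [] = 0"
      by (auto simp: cocycles_def delta_eq_zero_iff_0 centre_iff zero_prod_def)
    then have "B xs = 0" for xs by (cases xs) (simp_all add: supported_def)
    then show "B \<in> {0}" by (simp add: fun_eq_iff)
  qed (simp add: cocycles_def multilinear_zero supported_zero delta_linear)
  then show "BB 0 = of_coch 0 ` {B \<in> cocycles 0. snd (snd (snd (B []))) = (0 :: 'r)}"
    by (simp add: BB_0)
qed

section \<open>Degree one: derivations modulo inner derivations\<close>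

lemma delta_eq_zero_iff_1:
  assumes "supported 1 F"
  shows "delta F = 0 \<longleftrightarrow> (\<forall>a b. F [a \<star> b] = lmul a (F [b]) + rmul (F [a]) b)"
proof
  assume "delta F = 0"
  then have "delta F [a, b] = 0" for a b by simp
  then show "\<forall>a b. F [a \<star> b] = lmul a (F [b]) + rmul (F [a]) b"
    by (simp add: algebra_simps)
next
  assume "\<forall>a b. F [a \<star> b] = lmul a (F [b]) + rmul (F [a]) b"
  then have "delta F [a, b] = 0" for a b by simp
  then have "delta F xs = 0" for xs
    using supported_delta[OF assms]
    by (cases "length xs = 2") (auto simp: length_Suc_conv numeral_2_eq_2 supported_def)
  then show "delta F = 0" by (simp add: fun_eq_iff)
qed

text \<open>The inner derivation of \<open>E\<^bsub>31\<^esub>\<close> has opposite components at \<open>x\<close> and \<open>y\<close>, so their sum is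
  constant on classes.\<close>

definition outer :: "'r::comm_ring_1 coch \<Rightarrow> 'r" where
  "outer F = fst (snd (snd (F [aX]))) + fst (F [aY])"

lemma outer_delta: "outer (delta G) = 0"
  by (cases "G []") (simp add: outer_def basis_defs)

lemma derivation_inner:
  assumes F: "multilinear F" and der: "\<And>a b. F [a \<star> b] = lmul a (F [b]) + rmul (F [a]) b"
    and outer: "outer F = 0"
  shows "\<exists>m. \<forall>a. F [a] = lmul a m - rmul m a"
proof -
  \<comment> \<open>The inner derivation of (p, w, q, f) takes the value (-p, 0, q, 0) at u and (0,
    0, -w, p) at x. So p and q are read off from \<open>F [aU]\<close> and w from
    \<open>F [aX]\<close>, while f is central and set to 0.\<close>
  define m where "m = (- fst (F [aU]), - fst (snd (snd (F [aX]))), fst (snd (snd (F [aU]))), 0 :: 'a)"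
  define D where "D = (\<lambda>a. F [a] - (lmul a m - rmul m a))"
  have D: "D (a \<star> b) = lmul a (D b) + rmul (D a) b" for a b
    by (simp add: D_def der lmul_linear rmul_linear lmul_lmul rmul_rmul lmul_rmul algebra_simps)
  have D0: "D 0 = 0" using multilinear_hd_zero[OF F] by (simp add: D_def)
  have "D aU = 0"
    using D[of aU aU]
    by (cases "D aU"; cases "F [aU]") (auto simp: D_def m_def basis_defs zero_prod_def)
  moreover have "D aE = 0"
    using D[of aE aE] D[of aU aE] D[of aE aU] calculation
    by (cases "D aE") (simp add: D0; simp add: basis_defs zero_prod_def)
  moreover have "D aX = 0"
    using D[of aU aX] D[of aX aE] calculation
    by (cases "D aX"; cases "F [aX]") (auto simp: D_def m_def basis_defs zero_prod_def)
  \<comment> \<open>Since y = ey, only the first coordinate of \<open>D aY\<close> can survive; by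
    the choice of w it equals \<open>outer F\<close>.\<close>
  moreover have "D aY = 0"
    using D[of aE aY] D[of aY aU] calculation outer
    by (cases "D aY"; cases "F [aY]")
      (auto simp: outer_def D_def m_def basis_defs zero_prod_def add_eq_0_iff)
  moreover have "D aZ = 0"
    using D[of aX aY] calculation by simp
  ultimately have "D a = 0" for a
    by (rule_tac alg_ext[where P = D])
      (simp_all add: D_def multilinear_hd[OF F] lmul_linear rmul_linear algebra_simps flip: mscale_linear(1,2))
  then show ?thesis by (intro exI[of _ m]) (simp add: D_def)
qed

lemma HH_1:
  "\<exists>\<psi>. bij_betw \<psi> (HH 1) (UNIV :: 'r::comm_ring_1 set) \<and>
           (\<forall>f\<in>ZZ 1. \<forall>g\<in>ZZ 1. \<psi> (hcls 1 (cadd 1 f g)) = \<psi> (hcls 1 f) + \<psi> (hcls 1 g)) \<and>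
           (\<forall>f\<in>ZZ 1. \<forall>r. \<psi> (hcls 1 (csmult 1 r f)) = r * \<psi> (hcls 1 f))"
proof (rule HH_iso[where T = outer])
  fix F G :: "'r coch" and r :: 'r
  show "outer (F + G) = outer F + outer G" by (simp add: outer_def)
  show "outer (\<lambda>xs. mscale r (F xs)) = r * outer F"
    by (cases "F [aX]"; cases "F [aY]") (simp add: outer_def algebra_simps)
  \<comment> \<open>The derivation that sends x to r E32 and kills u, e and y; at z = xy its value
    must be r E32 E23 = r E33 = - r E11.\<close>
  define d :: "'r alg \<Rightarrow> 'r quot" where "d = (\<lambda>(a, b, c, d, e). (0, 0, r * b, - r * c))"
  define F1 where "F1 = (\<lambda>xs. case xs of [a] \<Rightarrow> d a | _ \<Rightarrow> 0)"
  have d: "d (a + b) = d a + d b" "d (ascale s a) = mscale s (d a)"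
    "d (a \<star> b) = lmul a (d b) + rmul (d a) b" for a b s
    by (cases a; cases b; simp add: d_def algebra_simps)+
  have "F1 (as @ a # bs) = (if as = [] \<and> bs = [] then d a else 0)" for as bs a
    by (cases as; cases bs) (simp_all add: F1_def split: list.split)
  then have "multilinear F1"
    unfolding multilinear_def by (auto simp: d)
  moreover have F1: "supported 1 F1"
    unfolding supported_def F1_def by (simp split: list.split)
  moreover have "delta F1 = 0"
    unfolding delta_eq_zero_iff_1[OF F1] by (simp add: F1_def d)
  ultimately have "F1 \<in> cocycles 1"
    unfolding cocycles_def by blast
  moreover have "outer F1 = r"
    by (simp add: F1_def d_def outer_def basis_defs)
  ultimately show "\<exists>F\<in>cocycles 1. outer F = r" by blast
next
  have "{delta G |G. multilinear G \<and> supported 0 G} = {B \<in> cocycles 1. outer B = (0 :: 'r)}"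
  proof (intro equalityI subsetI)
    fix B :: "'r coch"
    assume "B \<in> {delta G |G. multilinear G \<and> supported 0 G}"
    then show "B \<in> {B \<in> cocycles 1. outer B = 0}"
      using supported_delta[of 0]
      by (auto simp: cocycles_def outer_delta multilinear_delta delta_delta)
  next
    fix B :: "'r coch"
    assume B: "B \<in> {B \<in> cocycles 1. outer B = 0}"
    then have sB: "supported 1 B" by (simp add: cocycles_def)
    obtain m where m: "\<And>a. B [a] = lmul a m - rmul m a"
      using B derivation_inner[of B] delta_eq_zero_iff_1[OF sB] by (auto simp: cocycles_def)
    define G where "G = (\<lambda>xs :: 'r alg list. if xs = [] then m else 0)"
    have G: "multilinear G" "supported 0 G"
      by (simp_all add: G_def multilinear_def supported_def)
    have "B xs = delta G xs" for xs
    proof (cases "length xs = 1")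
      case True
      then show ?thesis by (auto simp: length_Suc_conv G_def m)
    next
      case False
      then show ?thesis using sB supported_delta[OF G(2)] by (simp add: supported_def)
    qed
    then show "B \<in> {delta G |G. multilinear G \<and> supported 0 G}"
      using G by (auto simp: fun_eq_iff)
  qed
  then show "BB 1 = of_coch 1 ` {B \<in> cocycles 1. outer B = (0 :: 'r)}"
    by (simp add: BB_Suc)
qed

section \<open>Degrees at least two\<close>

lemma HH_ge2:
  assumes "n \<ge> 2"
  shows "HH n = {ZZ n :: ('r::comm_ring_1 mat list \<Rightarrow> 'r mat set) set}"
proof -
  obtain k where n: "n = Suc k" "k \<ge> 1" using assms by (cases n) auto
  \<comment> \<open>The condition \<open>0 = 0\<close> is \<open>T B = 0\<close> for the zero
    functional, in the form needed by \<open>hcls_of_coch\<close>.\<close>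
  have "{delta G |G. multilinear G \<and> supported k G} = {B :: 'r coch. B \<in> cocycles n \<and> (0 :: 'r) = 0}"
  proof (intro equalityI subsetI)
    fix B :: "'r coch"
    assume "B \<in> {delta G |G. multilinear G \<and> supported k G}"
    then show "B \<in> {B \<in> cocycles n. (0 :: 'r) = 0}"
      by (auto simp: cocycles_def multilinear_delta delta_delta supported_delta n)
  next
    fix B :: "'r coch"
    assume B: "B \<in> {B \<in> cocycles n. (0 :: 'r) = 0}"
    then obtain G where G: "multilinear G" "delta G = B"
      using cocycle_exact[of B] n by (auto simp: cocycles_def supported_def)
    \<comment> \<open>\<open>cocycle_exact\<close> may give a primitive with components in every
      degree; the round trip through matrix cochains keeps only degree \<open>k\<close>, on which
      \<open>delta\<close> in degree \<open>n\<close> depends.\<close>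
    define H where "H = to_coch k (of_coch k G)"
    have H: "multilinear H" "supported k H"
      unfolding H_def by (simp_all add: multilinear_to_coch cochain_of_coch G)
    have "B xs = delta H xs" for xs
    proof (cases "length xs = n")
      case True
      then show ?thesis
        unfolding G(2)[symmetric] H_def by (intro delta_cong) (simp add: to_coch_of_coch n)
    next
      case False
      then show ?thesis using B supported_delta[OF H(2)] by (simp add: cocycles_def supported_def n)
    qed
    then show "B \<in> {delta G |G. multilinear G \<and> supported k G}"
      using H by (auto simp: fun_eq_iff)
  qed
  then have "BB n = of_coch n ` {B :: 'r coch. B \<in> cocycles n \<and> (0 :: 'r) = 0}"
    by (simp add: n BB_Suc)
  then have "hcls n (of_coch n F) = ZZ n" if "F \<in> cocycles n" for F :: "'r coch"
    using hcls_of_coch[of "\<lambda>_. 0 :: 'r" n F] that by (simp add: ZZ_eq)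
  moreover have "0 \<in> (cocycles n :: 'r coch set)"
    by (simp add: cocycles_def multilinear_zero supported_zero delta_linear)
  ultimately show ?thesis
    unfolding HH_def ZZ_eq image_image by force
qed

theorem theorem5p11:
  fixes n :: nat
  shows "(n \<le> 1 \<longrightarrow>
            (\<exists>\<psi> :: (('r::comm_ring_1) mat list \<Rightarrow> 'r mat set) set \<Rightarrow> 'r.
               bij_betw \<psi> (HH n) UNIV \<and>
               (\<forall>f\<in>ZZ n. \<forall>g\<in>ZZ n. \<psi> (hcls n (cadd n f g)) = \<psi> (hcls n f) + \<psi> (hcls n g)) \<and>
               (\<forall>f\<in>ZZ n. \<forall>r. \<psi> (hcls n (csmult n r f)) = r * \<psi> (hcls n f))))
       \<and> (n \<ge> 2 \<longrightarrow> (\<exists>c. (HH n :: (('r::comm_ring_1) mat list \<Rightarrow> 'r mat set) set set) = {c}))"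
proof (intro conjI impI)
  assume "n \<le> 1"
  then consider "n = 0" | "n = 1" by linarith
  then show "\<exists>\<psi> :: ('r mat list \<Rightarrow> 'r mat set) set \<Rightarrow> 'r.
               bij_betw \<psi> (HH n) UNIV \<and>
               (\<forall>f\<in>ZZ n. \<forall>g\<in>ZZ n. \<psi> (hcls n (cadd n f g)) = \<psi> (hcls n f) + \<psi> (hcls n g)) \<and>
               (\<forall>f\<in>ZZ n. \<forall>r. \<psi> (hcls n (csmult n r f)) = r * \<psi> (hcls n f))"
    by cases (simp_all only: HH_0 HH_1)
qed (use HH_ge2 in blast)

end
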